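(* The following maps $\mathcal M\to\mathbb R^3$ have $\sigma$-Lagrangian fibres: $$(\mathbf u,\mathbf v)\mapsto\mathbf u+\mathbf v,\qquad(\mathbf u,\mathbf v)\mapsto(u+v)(\mathbf u-\mathbf v),\qquad(\mathbf u,\mathbf v)\mapsto\mathbf u\sqrt{u+v},\qquad(\mathbf u,\mathbf v)\mapsto\mathbf v\sqrt{u+v}.$$
   Context: Let $x_0,\dots,x_7$ be the standard coordinates on $\mathbb R^8$, with partial derivatives $\partial_i$, and let $e=\sum_i dx_i\otimes dx_i$ and $R=\sum_i x_i^2$. Put $X=-x_1\partial_0+x_0\partial_1-x_3\partial_2+x_2\partial_3-x_5\partial_4+x_4\partial_5-x_7\partial_6+x_6\partial_7$, $Y_1=-x_1\partial_0+x_0\partial_1+x_3\partial_2-x_2\partial_3-x_5\partial_4+x_4\partial_5+x_7\partial_6-x_6\partial_7$, $Y_2=-x_2\partial_0+x_0\partial_2+x_1\partial_3-x_3\partial_1-x_6\partial_4+x_4\partial_6+x_5\partial_7-x_7\partial_5$, $Y_3=-x_3\partial_0+x_0\partial_3+x_2\partial_1-x_1\partial_2-x_7\partial_4+x_4\partial_7+x_6\partial_5-x_5\partial_6$, $\alpha_i=e(Y_i,\cdot)$ and $\hat\alpha_i=\alpha_i/R$. The flow of $Y_1$ is a free circle action on $\mathbb R^8\setminus0$ with quotient $\mathcal C=\mathbb R^+\times\mathbb{CP}^3$; tensors on $\mathcal C$ are identified with their pullbacks to $\mathbb R^8\setminus 0$. The conical $G_2$ structure on $\mathcal C$ has 3-form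 $\varphi=d(\tfrac13R^3\omega)$, where $\omega=d\hat\alpha_1+3\hat\alpha_2\wedge\hat\alpha_3$. The vector field $X$ generates a circle action on $\mathcal C$ preserving $\varphi$; its quotient is $Q:\mathcal C\to\mathcal M\cong\mathbb R^6\setminus0$, with coordinates $(\mathbf u,\mathbf v)=(u_1,u_2,u_3;v_1,v_2,v_3)$ given by $u_1=x_0^2+x_1^2-x_4^2-x_5^2$, $u_2=2(x_0x_4+x_1x_5)$, $u_3=2(x_0x_5-x_1x_4)$, $v_1=x_2^2+x_3^2-x_6^2-x_7^2$, $v_2=2(x_2x_6+x_3x_7)$, $v_3=2(x_2x_7-x_3x_6)$. Also $u=|\mathbf u|$, $v=|\mathbf v|$, $R=u+v$. The symplectic form $\sigma$ on $\mathcal M$ is the 2-form to which $X\lrcorner\varphi$ descends; explicitly $\sigma=-\tfrac12\sum_{i=1}^3dp_i\wedge dq_i$ with $\mathbf p=\mathbf u+\mathbf v$, $\mathbf q=R(\mathbf u-\mathbf v)$. A fibre is $\sigma$-Lagrangian if it is 3-dimensional and $\sigma$ pulls back to zero on it. *)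

theory Defs
  imports "HOL-Analysis.Analysis"
begin

text \<open>
  A differential form is a function of the base point and of its vector arguments. The wedge
  product and the exterior derivative carry no combinatorial factors:
  \<open>(\<alpha> \<and> \<beta>)(a, b) = \<alpha>(a) \<beta>(b) - \<alpha>(b) \<beta>(a)\<close>. Only constant vector fields are plugged into the
  formulas for the exterior derivative, so no bracket terms occur.
\<close>

type_synonym 'a form1 = "'a \<Rightarrow> 'a \<Rightarrow> real"
type_synonym 'a form2 = "'a \<Rightarrow> 'a \<Rightarrow> 'a \<Rightarrow> real"
type_synonym 'a form3 = "'a \<Rightarrow> 'a \<Rightarrow> 'a \<Rightarrow> 'a \<Rightarrow> real"

definition wedge :: "'a form1 \<Rightarrow> 'a form1 \<Rightarrow> 'a form2" where
  "wedge \<alpha> \<beta> x a b = \<alpha> x a * \<beta> x b - \<alpha> x b * \<beta> x a"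

definition ext_d1 :: "('a::real_normed_vector) form1 \<Rightarrow> 'a form2" where
  "ext_d1 \<alpha> x a b =
     frechet_derivative (\<lambda>y. \<alpha> y b) (at x) a - frechet_derivative (\<lambda>y. \<alpha> y a) (at x) b"

definition ext_d2 :: "('a::real_normed_vector) form2 \<Rightarrow> 'a form3" where
  "ext_d2 \<beta> x a b c =
     frechet_derivative (\<lambda>y. \<beta> y b c) (at x) a
   - frechet_derivative (\<lambda>y. \<beta> y a c) (at x) b
   + frechet_derivative (\<lambda>y. \<beta> y a b) (at x) c"

definition interior_product :: "('a \<Rightarrow> 'a) \<Rightarrow> 'a form3 \<Rightarrow> 'a form2" where
  "interior_product V \<phi> x a b = \<phi> x (V x) a b"

text \<open>
  The index type \<open>8\<close> has the elements \<open>0, \<dots>, 7\<close>, so \<open>x $ i\<close> is the coordinate \<open>x\<^sub>i\<close> with the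
  numbering starting at zero.
\<close>

abbreviation partial :: "8 \<Rightarrow> real^8" where
  "partial i \<equiv> axis i 1"

definition X :: "real^8 \<Rightarrow> real^8" where
  "X x = - (x$1) *\<^sub>R partial 0 + (x$0) *\<^sub>R partial 1 - (x$3) *\<^sub>R partial 2 + (x$2) *\<^sub>R partial 3
         - (x$5) *\<^sub>R partial 4 + (x$4) *\<^sub>R partial 5 - (x$7) *\<^sub>R partial 6 + (x$6) *\<^sub>R partial 7"

definition Y1 :: "real^8 \<Rightarrow> real^8" where
  "Y1 x = - (x$1) *\<^sub>R partial 0 + (x$0) *\<^sub>R partial 1 + (x$3) *\<^sub>R partial 2 - (x$2) *\<^sub>R partial 3
          - (x$5) *\<^sub>R partial 4 + (x$4) *\<^sub>R partial 5 + (x$7) *\<^sub>R partial 6 - (x$6) *\<^sub>R partial 7"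

definition Y2 :: "real^8 \<Rightarrow> real^8" where
  "Y2 x = - (x$2) *\<^sub>R partial 0 + (x$0) *\<^sub>R partial 2 + (x$1) *\<^sub>R partial 3 - (x$3) *\<^sub>R partial 1
          - (x$6) *\<^sub>R partial 4 + (x$4) *\<^sub>R partial 6 + (x$5) *\<^sub>R partial 7 - (x$7) *\<^sub>R partial 5"

definition Y3 :: "real^8 \<Rightarrow> real^8" where
  "Y3 x = - (x$3) *\<^sub>R partial 0 + (x$0) *\<^sub>R partial 3 + (x$2) *\<^sub>R partial 1 - (x$1) *\<^sub>R partial 2
          - (x$7) *\<^sub>R partial 4 + (x$4) *\<^sub>R partial 7 + (x$6) *\<^sub>R partial 5 - (x$5) *\<^sub>R partial 6"

definition R :: "real^8 \<Rightarrow> real" where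
  "R x = (\<Sum>i\<in>UNIV. (x$i)\<^sup>2)"

definition flat :: "(real^8 \<Rightarrow> real^8) \<Rightarrow> (real^8) form1" where
  "flat Y x a = Y x \<bullet> a"

definition hat_alpha :: "(real^8 \<Rightarrow> real^8) \<Rightarrow> (real^8) form1" where
  "hat_alpha Y x a = flat Y x a / R x"

definition omega :: "(real^8) form2" where
  "omega x a b = ext_d1 (hat_alpha Y1) x a b + 3 * wedge (hat_alpha Y2) (hat_alpha Y3) x a b"

text \<open>Tensors on the cone \<open>\<real>\<^sup>+ \<times> \<complex>\<P>\<^sup>3\<close> are written as their pullbacks to \<open>\<real>\<^sup>8\<close> minus the origin.\<close>

definition phi :: "(real^8) form3" where
  "phi = ext_d2 (\<lambda>x a b. 1/3 * R x ^ 3 * omega x a b)"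

type_synonym R6 = "(real^3) \<times> (real^3)"

definition M :: "R6 set" where
  "M = - {0}"

text \<open>The quotient map \<open>Q\<close>, precomposed with the projection from \<open>\<real>\<^sup>8\<close> minus the origin to the cone.\<close>

definition Q :: "real^8 \<Rightarrow> R6" where
  "Q x =
    (vector [(x$0)\<^sup>2 + (x$1)\<^sup>2 - (x$4)\<^sup>2 - (x$5)\<^sup>2,
             2 * (x$0 * x$4 + x$1 * x$5),
             2 * (x$0 * x$5 - x$1 * x$4)],
     vector [(x$2)\<^sup>2 + (x$3)\<^sup>2 - (x$6)\<^sup>2 - (x$7)\<^sup>2,
             2 * (x$2 * x$6 + x$3 * x$7),
             2 * (x$2 * x$7 - x$3 * x$6)])"

text \<open>
  \<open>\<sigma>\<close> is the form to which \<open>X \<lrcorner> \<phi>\<close> descends: \<open>Q\<^sup>*\<sigma> = X \<lrcorner> \<phi>\<close>. At a point with \<open>\<^bold>u \<noteq> 0\<close> and \<open>\<^bold>v \<noteq> 0\<close> the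
  derivative of \<open>Q\<close> is onto, so \<open>\<sigma>\<close> is uniquely determined there; it is \<open>-1/2 \<Sum> dp\<^sub>i \<and> dq\<^sub>i\<close>.
  Over the image of the fixed points of the circle action (\<open>\<^bold>u = 0\<close> or \<open>\<^bold>v = 0\<close>) the range of the
  derivative of \<open>Q\<close> is the tangent space of the singular stratum, and \<open>\<sigma>\<close> is determined on that
  subspace only.
\<close>

definition descends_to :: "(real^8) form2 \<Rightarrow> R6 form2 \<Rightarrow> bool" where
  "descends_to \<beta> \<sigma> \<longleftrightarrow>
     (\<forall>x. x \<noteq> 0 \<longrightarrow>
       (\<forall>a b. \<sigma> (Q x) (frechet_derivative Q (at x) a) (frechet_derivative Q (at x) b) = \<beta> x a b))"

text \<open>The open stratum \<open>\<^bold>u \<noteq> 0 \<noteq> \<^bold>v\<close> or one of the two singular strata, whichever contains \<open>z\<close>.\<close>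

definition stratum :: "R6 \<Rightarrow> R6 set" where
  "stratum z = {w \<in> M. (fst w = 0 \<longleftrightarrow> fst z = 0) \<and> (snd w = 0 \<longleftrightarrow> snd z = 0)}"

definition tangent_vectors :: "R6 set \<Rightarrow> R6 \<Rightarrow> R6 set" where
  "tangent_vectors S z =
     {\<xi>. \<exists>\<gamma>::real \<Rightarrow> R6. \<gamma> 0 = z \<and> (\<forall>t. \<gamma> t \<in> S) \<and> (\<gamma> has_vector_derivative \<xi>) (at 0)}"

definition locally_R3_at :: "R6 set \<Rightarrow> R6 \<Rightarrow> bool" where
  "locally_R3_at F z \<longleftrightarrow>
     (\<exists>U V. openin (top_of_set F) U \<and> z \<in> U \<and> open (V :: (real^3) set) \<and> U homeomorphic V)"

text \<open>Near \<open>z\<close>, the set \<open>F\<close> is an embedded submanifold of \<open>\<real>\<^sup>6\<close> of codimension 3, hence of dimension 3.\<close>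

definition C1_submanifold3_at :: "R6 set \<Rightarrow> R6 \<Rightarrow> bool" where
  "C1_submanifold3_at F z \<longleftrightarrow>
     (\<exists>U (g :: R6 \<Rightarrow> real^3) (g' :: R6 \<Rightarrow> (R6 \<Rightarrow>\<^sub>L (real^3))).
        open U \<and> z \<in> U \<and>
        (\<forall>y\<in>U. (g has_derivative blinfun_apply (g' y)) (at y)) \<and>
        continuous_on U g' \<and>
        (\<forall>y\<in>U. surj (blinfun_apply (g' y))) \<and>
        F \<inter> U = {y \<in> U. g y = 0})"

text \<open>
  The quotient \<open>\<M>\<close> is singular where \<open>\<^bold>u = 0\<close> or \<open>\<^bold>v = 0\<close>, and a fibre that crosses this locus may have a
  conical point on it. Such a fibre is still required to be a topological manifold there.
\<close>

definition three_dimensional :: "R6 set \<Rightarrow> bool" where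
  "three_dimensional F \<longleftrightarrow>
     (\<forall>z\<in>F. locally_R3_at F z) \<and>
     (\<forall>z\<in>F. fst z \<noteq> 0 \<and> snd z \<noteq> 0 \<longrightarrow> C1_submanifold3_at F z)"

text \<open>
  Where \<open>z\<close> is regular the stratum is open, and the tangent vectors below are those of \<open>F\<close>. On the
  singular strata only the directions on which \<open>\<sigma>\<close> is determined are tested.
\<close>

definition pulls_back_to_zero :: "R6 form2 \<Rightarrow> R6 set \<Rightarrow> bool" where
  "pulls_back_to_zero \<sigma> F \<longleftrightarrow>
     (\<forall>z\<in>F. \<forall>\<xi>\<in>tangent_vectors (F \<inter> stratum z) z. \<forall>\<eta>\<in>tangent_vectors (F \<inter> stratum z) z.
        \<sigma> z \<xi> \<eta> = 0)"

definition lagrangian :: "R6 form2 \<Rightarrow> R6 set \<Rightarrow> bool" where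
  "lagrangian \<sigma> F \<longleftrightarrow> three_dimensional F \<and> pulls_back_to_zero \<sigma> F"

definition has_lagrangian_fibres :: "R6 form2 \<Rightarrow> (R6 \<Rightarrow> real^3) \<Rightarrow> bool" where
  "has_lagrangian_fibres \<sigma> f \<longleftrightarrow> (\<forall>c \<in> f ` M. lagrangian \<sigma> {z \<in> M. f z = c})"

end

theory Submission
  imports Defs
begin

text \<open>
  The factor \<open>R\<^sup>3\<close> clears the denominators of \<open>\<omega>\<close>, so \<open>X \<lrcorner> \<phi>\<close> is a polynomial form on \<open>\<real>\<^sup>8\<close>, and
  comparing polynomials shows that it is the pullback of \<open>- 1/2 \<Sum> dp\<^sub>i \<and> dq\<^sub>i\<close>. The map \<open>Q\<close> is a pair of
  Hopf maps, hence a submersion onto each stratum, which identifies \<open>\<sigma>\<close> there.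

  All four maps have the form \<open>z \<mapsto> r\<^sup>s L(z)\<close> with \<open>r = |u| + |v|\<close>, \<open>L\<close> linear and onto, and
  \<open>s \<in> {0, 1, 1/2}\<close>. Since \<open>r\<close> is homogeneous of degree \<open>1\<close>, the map \<open>z \<mapsto> r\<^sup>s z\<close> is a homeomorphism of \<open>\<M>\<close>
  with inverse \<open>z \<mapsto> r\<^sup>t z\<close>, \<open>t = - s / (1 + s)\<close>, so it straightens the fibres to affine
  3-spaces without the origin. A tangent vector \<open>\<xi>\<close> of a fibre satisfies
  \<open>L(\<xi>) = - s dr(\<xi>) / r L(z)\<close>, and this makes \<open>\<sigma>\<close> vanish; on the singular strata \<open>\<sigma>\<close> vanishes altogether.
\<close>

subsection \<open>The 3-form in coordinates\<close>

lemma UNIV_8: "(UNIV::8 set) = {0, 1, 2, 3, 4, 5, 6, 7}"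
proof -
  have "x \<in> {0, 1, 2, 3, 4, 5, 6, 7}" for x :: 8
  proof (induct x)
    case (of_int z)
    then have "z = 0 \<or> z = 1 \<or> z = 2 \<or> z = 3 \<or> z = 4 \<or> z = 5 \<or> z = 6 \<or> z = 7"
      by auto
    then show ?case by auto
  qed
  then show ?thesis by auto
qed

lemma sum_8: "sum f (UNIV::8 set) = f 0 + f 1 + f 2 + f 3 + f 4 + f 5 + f 6 + f 7"
  unfolding UNIV_8 by (simp add: add.assoc)

lemma vec_eq_iff_8:
  "(x::'a^8) = y \<longleftrightarrow> x$0 = y$0 \<and> x$1 = y$1 \<and> x$2 = y$2 \<and> x$3 = y$3 \<and>
     x$4 = y$4 \<and> x$5 = y$5 \<and> x$6 = y$6 \<and> x$7 = y$7"
proof -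
  have "(\<forall>i. x$i = y$i) \<longleftrightarrow> (\<forall>i\<in>UNIV. x$i = y$i)" by simp
  then show ?thesis unfolding vec_eq_iff UNIV_8 by auto
qed

lemma inner_8:
  "(a::real^8) \<bullet> b = a$0 * b$0 + a$1 * b$1 + a$2 * b$2 + a$3 * b$3
     + a$4 * b$4 + a$5 * b$5 + a$6 * b$6 + a$7 * b$7"
  by (simp add: inner_vec_def sum_8)

lemma inner_3: "(a::real^3) \<bullet> b = a$1 * b$1 + a$2 * b$2 + a$3 * b$3"
  by (simp add: inner_vec_def sum_3)

lemma vec_eq_iff_3: "(x::'a^3) = y \<longleftrightarrow> x$1 = y$1 \<and> x$2 = y$2 \<and> x$3 = y$3"
  by (simp add: vec_eq_iff forall_3)

lemma R_eq_inner: "R x = x \<bullet> x"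
  by (simp add: R_def inner_vec_def power2_eq_square)

lemma X_nth:
  "X x $ 0 = - (x$1)" "X x $ 1 = x$0" "X x $ 2 = - (x$3)" "X x $ 3 = x$2"
  "X x $ 4 = - (x$5)" "X x $ 5 = x$4" "X x $ 6 = - (x$7)" "X x $ 7 = x$6"
  by (simp_all add: X_def axis_def)

lemma Y1_nth:
  "Y1 x $ 0 = - (x$1)" "Y1 x $ 1 = x$0" "Y1 x $ 2 = x$3" "Y1 x $ 3 = - (x$2)"
  "Y1 x $ 4 = - (x$5)" "Y1 x $ 5 = x$4" "Y1 x $ 6 = x$7" "Y1 x $ 7 = - (x$6)"
  by (simp_all add: Y1_def axis_def)

lemma Y2_nth:
  "Y2 x $ 0 = - (x$2)" "Y2 x $ 1 = - (x$3)" "Y2 x $ 2 = x$0" "Y2 x $ 3 = x$1"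
  "Y2 x $ 4 = - (x$6)" "Y2 x $ 5 = - (x$7)" "Y2 x $ 6 = x$4" "Y2 x $ 7 = x$5"
  by (simp_all add: Y2_def axis_def)

lemma Y3_nth:
  "Y3 x $ 0 = - (x$3)" "Y3 x $ 1 = x$2" "Y3 x $ 2 = - (x$1)" "Y3 x $ 3 = x$0"
  "Y3 x $ 4 = - (x$7)" "Y3 x $ 5 = x$6" "Y3 x $ 6 = - (x$5)" "Y3 x $ 7 = x$4"
  by (simp_all add: Y3_def axis_def)

lemmas Y_nth = X_nth Y1_nth Y2_nth Y3_nth

text \<open>The fields are linear in the base point, so each is its own derivative.\<close>

lemma bounded_linear_Y:
  "bounded_linear Y1" "bounded_linear Y2" "bounded_linear Y3"
  unfolding linear_conv_bounded_linear[symmetric]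
  by (auto intro!: linearI simp: vec_eq_iff_8 Y_nth algebra_simps)

lemmas has_derivative_Y[derivative_intros] = bounded_linear_Y[THEN bounded_linear.has_derivative]

lemma Y1_antisym: "Y1 a \<bullet> b = - (Y1 b \<bullet> a)"
  by (simp add: inner_8 Y_nth algebra_simps)

text \<open>This is \<open>d\<alpha> / R - dR \<and> \<alpha> / R\<^sup>2\<close> for
  \<open>\<alpha> = flat Y1\<close>. Skew-symmetry of \<open>Y1\<close> merges the two halves of
  \<open>d\<alpha>\<close> into \<open>2 * (Y1 a \<bullet> b)\<close>, and
  \<open>dR(a) = 2 * (x \<bullet> a)\<close>.\<close>

lemma ext_d1_hat_alpha_Y1:
  assumes "x \<noteq> 0"
  shows "ext_d1 (hat_alpha Y1) x a b =
    2 * (Y1 a \<bullet> b) / R x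
    - 2 * ((x \<bullet> a) * (Y1 x \<bullet> b) - (x \<bullet> b) * (Y1 x \<bullet> a)) / (R x)\<^sup>2"
proof -
  have nz: "x \<bullet> x \<noteq> 0" using assms by simp
  have "((\<lambda>y. hat_alpha Y1 y b) has_derivative
      (\<lambda>h. (Y1 h \<bullet> b) / R x - 2 * (x \<bullet> h) * (Y1 x \<bullet> b) / (R x)\<^sup>2)) (at x)" for b
    unfolding hat_alpha_def flat_def R_eq_inner
    by ((rule derivative_eq_intros refl nz)+)
      (use nz in \<open>simp add: field_simps power2_eq_square inner_commute fun_eq_iff\<close>)
  then have "frechet_derivative (\<lambda>y. hat_alpha Y1 y b) (at x) =
      (\<lambda>h. (Y1 h \<bullet> b) / R x - 2 * (x \<bullet> h) * (Y1 x \<bullet> b) / (R x)\<^sup>2)" for b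
    by (rule frechet_derivative_at[symmetric])
  then show ?thesis
    unfolding ext_d1_def by (simp add: Y1_antisym[of b a] diff_divide_distrib algebra_simps)
qed

text \<open>The primitive of \<open>phi\<close> with its denominators cancelled, a polynomial in
  \<open>x\<close> that makes sense at the origin too.\<close>

definition cone_potential :: "(real^8) form2" where
  "cone_potential x a b =
     2/3 * (x \<bullet> x)\<^sup>2 * (Y1 a \<bullet> b)
     - 2/3 * (x \<bullet> x) * ((x \<bullet> a) * (Y1 x \<bullet> b) - (x \<bullet> b) * (Y1 x \<bullet> a))
     + (x \<bullet> x) * ((Y2 x \<bullet> a) * (Y3 x \<bullet> b) - (Y2 x \<bullet> b) * (Y3 x \<bullet> a))"

definition cone_potential_deriv :: "real^8 \<Rightarrow> real^8 \<Rightarrow> real^8 \<Rightarrow> real^8 \<Rightarrow> real" where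
  "cone_potential_deriv x h a b =
     8/3 * (x \<bullet> x) * (x \<bullet> h) * (Y1 a \<bullet> b)
     - 4/3 * (x \<bullet> h) * ((x \<bullet> a) * (Y1 x \<bullet> b) - (x \<bullet> b) * (Y1 x \<bullet> a))
     - 2/3 * (x \<bullet> x) * ((h \<bullet> a) * (Y1 x \<bullet> b) + (x \<bullet> a) * (Y1 h \<bullet> b)
                       - (h \<bullet> b) * (Y1 x \<bullet> a) - (x \<bullet> b) * (Y1 h \<bullet> a))
     + 2 * (x \<bullet> h) * ((Y2 x \<bullet> a) * (Y3 x \<bullet> b) - (Y2 x \<bullet> b) * (Y3 x \<bullet> a))
     + (x \<bullet> x) * ((Y2 h \<bullet> a) * (Y3 x \<bullet> b) + (Y2 x \<bullet> a) * (Y3 h \<bullet> b)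
                - (Y2 h \<bullet> b) * (Y3 x \<bullet> a) - (Y2 x \<bullet> b) * (Y3 h \<bullet> a))"

lemma omega_eq_cone_potential:
  assumes "x \<noteq> 0"
  shows "1/3 * R x ^ 3 * omega x a b = cone_potential x a b"
  using assms
  by (simp add: omega_def ext_d1_hat_alpha_Y1 wedge_def hat_alpha_def flat_def
      cone_potential_def R_eq_inner field_simps power2_eq_square power3_eq_cube)

lemma cone_potential_has_derivative:
  "((\<lambda>x. cone_potential x a b) has_derivative (\<lambda>h. cone_potential_deriv x h a b)) (at x)"
  unfolding cone_potential_def cone_potential_deriv_def
  by ((rule derivative_eq_intros refl)+)
    (simp add: inner_commute fun_eq_iff, simp add: algebra_simps power2_eq_square)

lemma phi_eq:
  assumes "x \<noteq> 0"
  shows "phi x a b c = cone_potential_deriv x a b c - cone_potential_deriv x b a c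
    + cone_potential_deriv x c a b"
proof -
  have "((\<lambda>y. 1/3 * R y ^ 3 * omega y b c) has_derivative
      (\<lambda>h. cone_potential_deriv x h b c)) (at x)" for b c
    \<comment> \<open>The two primitives are known to agree off the origin only; that set is open,
      so the derivative carries over.\<close>
    by (rule has_derivative_transform_within_open[OF cone_potential_has_derivative, of "- {0}"])
      (use assms omega_eq_cone_potential in auto)
  then have "frechet_derivative (\<lambda>y. 1/3 * R y ^ 3 * omega y b c) (at x) =
      (\<lambda>h. cone_potential_deriv x h b c)" for b c
    by (rule frechet_derivative_at[symmetric])
  then show ?thesis
    by (simp add: phi_def ext_d2_def)
qed

subsection \<open>The quotient map and the descended form\<close>

text \<open>With \<open>z = p + i q\<close> and \<open>w = r + i s\<close> this is the Hopf map
  \<open>(|z|\<^sup>2 - |w|\<^sup>2, 2 conj(z) w)\<close>.\<close>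

definition hopf :: "real \<Rightarrow> real \<Rightarrow> real \<Rightarrow> real \<Rightarrow> real^3" where
  "hopf p q r s = vector [p\<^sup>2 + q\<^sup>2 - r\<^sup>2 - s\<^sup>2, 2 * (p * r + q * s), 2 * (p * s - q * r)]"

definition hopf_deriv :: "real \<Rightarrow> real \<Rightarrow> real \<Rightarrow> real \<Rightarrow> real \<Rightarrow> real \<Rightarrow> real \<Rightarrow> real \<Rightarrow> real^3" where
  "hopf_deriv p q r s a b c d =
     vector [2 * (p * a + q * b - r * c - s * d),
             2 * (p * c + a * r + q * d + b * s),
             2 * (p * d + a * s - q * c - b * r)]"

lemma Q_eq_hopf: "Q x = (hopf (x$0) (x$1) (x$4) (x$5), hopf (x$2) (x$3) (x$6) (x$7))"
  by (simp add: Q_def hopf_def)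

definition Q_deriv :: "real^8 \<Rightarrow> real^8 \<Rightarrow> R6" where
  "Q_deriv x a = (hopf_deriv (x$0) (x$1) (x$4) (x$5) (a$0) (a$1) (a$4) (a$5),
                  hopf_deriv (x$2) (x$3) (x$6) (x$7) (a$2) (a$3) (a$6) (a$7))"

lemma has_derivative_vector_3:
  assumes "(f has_derivative f') F" "(g has_derivative g') F" "(h has_derivative h') F"
  shows "((\<lambda>x. vector [f x, g x, h x] :: real^3) has_derivative
    (\<lambda>y. vector [f' y, g' y, h' y])) F"
proof -
  have vec: "vector [a, b, c] = a *\<^sub>R axis 1 1 + b *\<^sub>R axis 2 1 + c *\<^sub>R (axis 3 1 :: real^3)"
    for a b c :: real
    by (simp add: vec_eq_iff_3 axis_def)
  show ?thesis
    unfolding vec by (intro derivative_intros assms)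
qed

lemma has_derivative_Q: "(Q has_derivative Q_deriv x) (at x)"
proof -
  have nth: "((\<lambda>x. x $ i) has_derivative (\<lambda>h. h $ i)) F" for i :: 8 and F :: "(real^8) filter"
    by (rule bounded_linear.has_derivative[OF bounded_linear_vec_nth has_derivative_ident])
  show ?thesis
    unfolding Q_def Q_deriv_def hopf_deriv_def
    by (intro has_derivative_Pair has_derivative_vector_3;
        (rule has_derivative_eq_rhs, (rule derivative_intros nth)+))
      (simp_all add: fun_eq_iff algebra_simps)
qed

text \<open>The right side is the pullback by \<open>Q\<close> of the expanded
  \<open>- 1/2 \<Sum> dp\<^sub>i \<and> dq\<^sub>i\<close>. Writing \<open>dR(a)\<close> as
  \<open>2 * (x \<bullet> a)\<close> avoids the norms of \<open>u\<close> and \<open>v\<close> and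
  leaves a polynomial identity.\<close>

lemma interior_product_phi:
  assumes "x \<noteq> 0"
  shows "interior_product X phi x a b =
    (x \<bullet> x) * (fst (Q_deriv x a) \<bullet> snd (Q_deriv x b) - fst (Q_deriv x b) \<bullet> snd (Q_deriv x a))
    + (x \<bullet> a) * ((fst (Q x) - snd (Q x)) \<bullet> (fst (Q_deriv x b) + snd (Q_deriv x b)))
    - (x \<bullet> b) * ((fst (Q x) - snd (Q x)) \<bullet> (fst (Q_deriv x a) + snd (Q_deriv x a)))"
  unfolding interior_product_def phi_eq[OF assms] cone_potential_deriv_def Q_deriv_def Q_eq_hopf
    hopf_def hopf_deriv_def fst_conv snd_conv inner_8 inner_3 Y_nth vector_3
    vector_add_component vector_minus_component
  by algebra

section \<open>Norm, image and rank of the Hopf map\<close>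

lemma norm_hopf: "norm (hopf p q r s) = p\<^sup>2 + q\<^sup>2 + r\<^sup>2 + s\<^sup>2"
proof (rule power2_eq_imp_eq)
  \<comment> \<open>The last two components contribute
    \<open>4 (p\<^sup>2 + q\<^sup>2) (r\<^sup>2 + s\<^sup>2)\<close> by the two-square
    identity.\<close>
  show "(norm (hopf p q r s))\<^sup>2 = (p\<^sup>2 + q\<^sup>2 + r\<^sup>2 + s\<^sup>2)\<^sup>2"
    unfolding power2_norm_eq_inner inner_3 hopf_def vector_3 by algebra
qed auto

lemma hopf_eq_0_iff: "hopf p q r s = 0 \<longleftrightarrow> p = 0 \<and> q = 0 \<and> r = 0 \<and> s = 0"
proof -
  have "hopf p q r s = 0 \<longleftrightarrow> p\<^sup>2 + q\<^sup>2 + r\<^sup>2 + s\<^sup>2 = 0"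
    by (metis norm_eq_zero norm_hopf)
  then show ?thesis
    by (auto simp: add_nonneg_eq_0_iff)
qed

lemma surj_hopf: "\<exists>p q r s. hopf p q r s = w"
\<comment> \<open>A preimage has \<open>p\<^sup>2 + q\<^sup>2 = (norm w + w$1) / 2\<close>. If this
  vanishes, \<open>w\<close> lies on the closed negative first axis; otherwise \<open>q = 0\<close>
  can be arranged and the other two components give \<open>r\<close> and \<open>s\<close> after
  division by \<open>2 * p\<close>.\<close>
proof (cases "norm w + w$1 = 0")
  case True
  have "(w$1)\<^sup>2 + (w$2)\<^sup>2 + (w$3)\<^sup>2 = (norm w)\<^sup>2"
    unfolding power2_norm_eq_inner inner_3 by (simp add: power2_eq_square)
  moreover have "(w$1)\<^sup>2 = (norm w)\<^sup>2"
    using True by (metis add_eq_0_iff power2_minus)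
  ultimately have "w$2 = 0" "w$3 = 0"
    by (auto simp: add_nonneg_eq_0_iff)
  then have "hopf 0 0 (sqrt (norm w)) 0 = w"
    using True by (simp add: hopf_def vec_eq_iff_3)
  then show ?thesis by blast
next
  case False
  have ge: "norm w + w$1 \<ge> 0"
    using component_le_norm_cart[of w 1] by linarith
  define p where "p = sqrt ((norm w + w$1) / 2)"
  have p2: "p\<^sup>2 = (norm w + w$1) / 2"
    unfolding p_def using ge by simp
  have p: "p \<noteq> 0"
    using p2 False by auto
  have "(w$1)\<^sup>2 + (w$2)\<^sup>2 + (w$3)\<^sup>2 = (norm w)\<^sup>2"
    unfolding power2_norm_eq_inner inner_3 by (simp add: power2_eq_square)
  then have "(w$2)\<^sup>2 + (w$3)\<^sup>2 = (norm w - w$1) * (norm w + w$1)"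
    by (simp add: algebra_simps power2_eq_square)
  also have "\<dots> = (norm w - w$1) * (2 * p\<^sup>2)"
    by (simp add: p2)
  finally have *: "(w$2)\<^sup>2 + (w$3)\<^sup>2 = 2 * (norm w - w$1) * p\<^sup>2"
    by simp
  have "((w$2)\<^sup>2 + (w$3)\<^sup>2) / (2 * p)\<^sup>2 = (norm w - w$1) / 2"
    unfolding * using p by (simp add: field_simps)
  then have "p\<^sup>2 - (w$2 / (2 * p))\<^sup>2 - (w$3 / (2 * p))\<^sup>2 = w$1"
    by (simp add: p2 power_divide diff_divide_distrib add_divide_distrib)
  then have "hopf p 0 (w$2 / (2 * p)) (w$3 / (2 * p)) = w"
    using p by (simp add: hopf_def vec_eq_iff_3)
  then show ?thesis by blast
qed

text \<open>The matrix \<open>D\<close> of \<open>hopf_deriv\<close> satisfies \<open>D D\<^sup>T = 4 (p\<^sup>2 + q\<^sup>2 + r\<^sup>2 + s\<^sup>2)\<close>, so a multiple of \<open>D\<^sup>T\<close> is a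
  right inverse.\<close>

lemma surj_hopf_deriv:
  assumes "hopf p q r s \<noteq> 0"
  shows "\<exists>a b c d. hopf_deriv p q r s a b c d = w"
proof -
  define n where "n = 2 * (p\<^sup>2 + q\<^sup>2 + r\<^sup>2 + s\<^sup>2)"
  have n: "n \<noteq> 0"
    using assms by (simp add: n_def norm_hopf[symmetric])
  have "hopf_deriv p q r s
      ((p * w$1 + r * w$2 + s * w$3) / n) ((q * w$1 + s * w$2 - r * w$3) / n)
      ((- r * w$1 + p * w$2 - q * w$3) / n) ((- s * w$1 + q * w$2 + p * w$3) / n) = w"
    unfolding hopf_deriv_def vec_eq_iff_3 vector_3
    using n by (simp add: divide_simps) (simp add: n_def algebra_simps power2_eq_square)
  then show ?thesis by blast
qed

text \<open>This differentiates \<open>norm_hopf\<close>. Since \<open>sgn 0 = 0\<close> it survives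
  at a zero of \<open>hopf\<close>, so \<open>radius_deriv\<close> pulls back to \<open>dR\<close>
  over the singular strata as well.\<close>

lemma sgn_hopf_inner_hopf_deriv:
  "sgn (hopf p q r s) \<bullet> hopf_deriv p q r s a b c d = 2 * (p * a + q * b + r * c + s * d)"
proof (cases "hopf p q r s = 0")
  case True
  moreover from True have "p = 0" "q = 0" "r = 0" "s = 0"
    by (simp_all add: hopf_eq_0_iff)
  ultimately show ?thesis by simp
next
  case False
  have "hopf p q r s \<bullet> hopf_deriv p q r s a b c d =
      norm (hopf p q r s) * (2 * (p * a + q * b + r * c + s * d))"
    unfolding norm_hopf unfolding inner_3 hopf_def hopf_deriv_def vector_3 by algebra
  with False show ?thesis
    by (simp add: sgn_div_norm divide_simps mult.commute)
qed

section \<open>The form on the quotient\<close>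

definition radius :: "R6 \<Rightarrow> real" where
  "radius z = norm (fst z) + norm (snd z)"

definition radius_deriv :: "R6 \<Rightarrow> R6 \<Rightarrow> real" where
  "radius_deriv z \<xi> = sgn (fst z) \<bullet> fst \<xi> + sgn (snd z) \<bullet> snd \<xi>"

text \<open>This is \<open>- 1/2 \<Sum> dp\<^sub>i \<and> dq\<^sub>i\<close> with \<open>p = u + v\<close> and \<open>q = R (u - v)\<close>, multiplied out. Because of
  \<open>sgn 0 = 0\<close> it also pulls back to \<open>X \<lrcorner> \<phi>\<close> over the singular strata.\<close>

definition sigma0 :: "R6 form2" where
  "sigma0 z \<xi> \<eta> =
     radius z * (fst \<xi> \<bullet> snd \<eta> - fst \<eta> \<bullet> snd \<xi>)
     + (radius_deriv z \<xi> * ((fst z - snd z) \<bullet> (fst \<eta> + snd \<eta>))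
        - radius_deriv z \<eta> * ((fst z - snd z) \<bullet> (fst \<xi> + snd \<xi>))) / 2"

lemma radius_Q: "radius (Q x) = x \<bullet> x"
  by (simp add: radius_def Q_eq_hopf norm_hopf inner_8 power2_eq_square)

lemma radius_deriv_Q: "radius_deriv (Q x) (Q_deriv x a) = 2 * (x \<bullet> a)"
  by (simp add: radius_deriv_def Q_eq_hopf Q_deriv_def sgn_hopf_inner_hopf_deriv inner_8)

lemma ex_vec_8:
  "\<exists>x::'a^8. x$0 = a \<and> x$1 = b \<and> x$2 = c \<and> x$3 = d \<and> x$4 = e \<and> x$5 = f \<and> x$6 = g \<and> x$7 = h"
  by (rule exI[of _ "\<chi> i. if i = 0 then a else if i = 1 then b else if i = 2 then c
      else if i = 3 then d else if i = 4 then e else if i = 5 then f else if i = 6 then g else h"])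
    simp

lemma surj_Q: "\<exists>x. Q x = z"
proof -
  obtain a b c d where "hopf a b c d = fst z" using surj_hopf by blast
  moreover obtain a' b' c' d' where "hopf a' b' c' d' = snd z" using surj_hopf by blast
  moreover obtain x :: "real^8" where "x$0 = a" "x$1 = b" "x$2 = a'" "x$3 = b'"
    "x$4 = c" "x$5 = d" "x$6 = c'" "x$7 = d'"
    using ex_vec_8 by metis
  ultimately have "Q x = z" by (simp add: Q_eq_hopf)
  then show ?thesis ..
qed

text \<open>A block of \<open>Q\<close> with nonzero value has onto derivative; a block with value
  zero has zero derivative, which is why the matching component of \<open>\<xi>\<close> must
  vanish.\<close>

lemma range_Q_deriv:
  assumes "fst (Q x) = 0 \<Longrightarrow> fst \<xi> = 0" "snd (Q x) = 0 \<Longrightarrow> snd \<xi> = 0"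
  shows "\<exists>a. Q_deriv x a = \<xi>"
proof -
  have onto: "\<exists>a b c d. hopf_deriv p q r s a b c d = w" if "hopf p q r s = 0 \<Longrightarrow> w = 0" for p q r s w
  proof (cases "hopf p q r s = 0")
    case True
    then have "hopf_deriv p q r s 0 0 0 0 = w"
      using that by (simp add: hopf_deriv_def vec_eq_iff_3)
    then show ?thesis by blast
  qed (rule surj_hopf_deriv)
  obtain a b c d where 1: "hopf_deriv (x$0) (x$1) (x$4) (x$5) a b c d = fst \<xi>"
    using onto assms(1) by (metis Q_eq_hopf fst_conv)
  obtain a' b' c' d' where 2: "hopf_deriv (x$2) (x$3) (x$6) (x$7) a' b' c' d' = snd \<xi>"
    using onto assms(2) by (metis Q_eq_hopf snd_conv)
  obtain y :: "real^8" where "y$0 = a" "y$1 = b" "y$2 = a'" "y$3 = b'"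
    "y$4 = c" "y$5 = d" "y$6 = c'" "y$7 = d'"
    using ex_vec_8 by metis
  with 1 2 have "Q_deriv x y = \<xi>" by (simp add: Q_deriv_def)
  then show ?thesis ..
qed

lemma descended_form_eq:
  assumes \<sigma>: "descends_to (interior_product X phi) \<sigma>" and "z \<in> M"
    and \<xi>: "fst z = 0 \<Longrightarrow> fst \<xi> = 0" "snd z = 0 \<Longrightarrow> snd \<xi> = 0"
    and \<eta>: "fst z = 0 \<Longrightarrow> fst \<eta> = 0" "snd z = 0 \<Longrightarrow> snd \<eta> = 0"
  shows "\<sigma> z \<xi> \<eta> = sigma0 z \<xi> \<eta>"
proof -
  obtain x where x: "Q x = z" using surj_Q by blast
  have "Q 0 = 0" by (simp add: Q_eq_hopf hopf_eq_0_iff prod_eq_iff)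
  then have "x \<noteq> 0" using x \<open>z \<in> M\<close> by (auto simp: M_def)
  obtain a where a: "Q_deriv x a = \<xi>" using range_Q_deriv[of x \<xi>] \<xi> x by blast
  obtain b where b: "Q_deriv x b = \<eta>" using range_Q_deriv[of x \<eta>] \<eta> x by blast
  have "frechet_derivative Q (at x) = Q_deriv x"
    by (rule frechet_derivative_at[symmetric]) (rule has_derivative_Q)
  then have "\<sigma> z \<xi> \<eta> = interior_product X phi x a b"
    using \<sigma> \<open>x \<noteq> 0\<close> unfolding descends_to_def by (metis a b x)
  also have "\<dots> = sigma0 (Q x) (Q_deriv x a) (Q_deriv x b)"
    unfolding interior_product_phi[OF \<open>x \<noteq> 0\<close>] sigma0_def radius_Q radius_deriv_Q
    by (simp add: field_simps)
  finally show ?thesis by (simp add: a b x)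
qed

subsection \<open>Fibres of rescaled linear maps\<close>

definition scaling :: "real \<Rightarrow> R6 \<Rightarrow> R6" where
  "scaling s z = radius z powr s *\<^sub>R z"

lemma radius_nonneg: "radius z \<ge> 0"
  by (simp add: radius_def)

lemma radius_eq_0_iff [simp]: "radius z = 0 \<longleftrightarrow> z = 0"
  by (simp add: radius_def add_nonneg_eq_0_iff prod_eq_iff)

lemma radius_pos: "z \<noteq> 0 \<Longrightarrow> radius z > 0"
  using radius_nonneg[of z] radius_eq_0_iff[of z] by linarith

lemma radius_scaleR: "radius (c *\<^sub>R z) = \<bar>c\<bar> * radius z"
  by (simp add: radius_def algebra_simps)

lemma scaling_eq_0_iff [simp]: "scaling s z = 0 \<longleftrightarrow> z = 0"
  by (simp add: scaling_def)

text \<open>One plus the exponent is multiplicative under composition, because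
  \<open>scaling s\<close> raises the radius to the power \<open>1 + s\<close>.\<close>

lemma scaling_scaling: "scaling t (scaling s z) = scaling (s + t * (1 + s)) z"
proof (cases "z = 0")
  case False
  then have "radius (scaling s z) = radius z powr (1 + s)"
    using radius_pos[of z] by (simp add: scaling_def radius_scaleR powr_add)
  then have "scaling t (scaling s z) = radius z powr ((1 + s) * t) *\<^sub>R radius z powr s *\<^sub>R z"
    unfolding scaling_def[of t] by (simp add: powr_powr scaling_def[of s])
  then show ?thesis
    by (simp add: scaling_def powr_add[symmetric] algebra_simps)
qed (simp add: scaling_def)

lemma scaling_0 [simp]: "scaling 0 z = z"
  by (cases "z = 0") (simp_all add: scaling_def)

lemma continuous_on_radius: "continuous_on S radius"
  unfolding radius_def by (intro continuous_intros)

lemma continuous_on_scaling: "continuous_on (- {0}) (scaling s)"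
  unfolding scaling_def
  by (intro continuous_intros continuous_on_radius) simp

section \<open>Differentiating the rescaled linear maps\<close>

lemma radius_has_derivative:
  assumes "fst z \<noteq> 0" "snd z \<noteq> 0"
  shows "(radius has_derivative radius_deriv z) (at z)"
proof -
  have "(norm has_derivative (\<lambda>h. sgn (fst z) \<bullet> h)) (at (fst z))"
    using assms(1) has_derivative_norm[of "fst z"] by (simp add: inner_commute)
  moreover have "(norm has_derivative (\<lambda>h. sgn (snd z) \<bullet> h)) (at (snd z))"
    using assms(2) has_derivative_norm[of "snd z"] by (simp add: inner_commute)
  ultimately show ?thesis
    unfolding radius_def[abs_def] radius_deriv_def[abs_def]
    by (intro has_derivative_add)
      (auto intro!: has_derivative_compose[of fst] has_derivative_compose[of snd] derivative_intros)
qed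

lemma bounded_linear_radius_deriv: "bounded_linear (radius_deriv z)"
  unfolding radius_deriv_def[abs_def]
  by (intro bounded_linear_add bounded_linear_inner_right_comp bounded_linear_fst bounded_linear_snd)

lemma radius_deriv_self: "radius_deriv z z = radius z"
proof -
  have "sgn x \<bullet> x = norm x" for x :: "real^3"
    by (cases "x = 0") (simp_all add: sgn_div_norm power2_norm_eq_inner[symmetric] power2_eq_square)
  then show ?thesis by (simp add: radius_deriv_def radius_def)
qed

definition fibration_deriv :: "real \<Rightarrow> (R6 \<Rightarrow> real^3) \<Rightarrow> R6 \<Rightarrow> R6 \<Rightarrow> real^3" where
  "fibration_deriv s L z \<xi> =
     radius z powr s *\<^sub>R L \<xi> + (s * radius z powr (s - 1) * radius_deriv z \<xi>) *\<^sub>R L z"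

lemma bounded_linear_fibration_deriv:
  assumes "bounded_linear L"
  shows "bounded_linear (fibration_deriv s L z)"
  unfolding fibration_deriv_def[abs_def]
  by (intro bounded_linear_add bounded_linear_const_scaleR assms
      bounded_linear_scaleR_const bounded_linear_const_mult bounded_linear_radius_deriv)

lemma fibration_has_derivative:
  assumes "bounded_linear L" "fst z \<noteq> 0" "snd z \<noteq> 0"
  shows "((\<lambda>z. radius z powr s *\<^sub>R L z) has_derivative fibration_deriv s L z) (at z)"
proof -
  have pos: "radius z > 0"
    using assms(2) by (intro radius_pos) auto
  have "((\<lambda>z. radius z powr s) has_derivative
      (\<lambda>\<xi>. s * radius z powr (s - 1) * radius_deriv z \<xi>)) (at z)"
    by (rule has_derivative_eq_rhs[OF has_derivative_powr[OF radius_has_derivative has_derivative_const]])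
      (use assms pos in \<open>auto simp: powr_diff fun_eq_iff\<close>)
  then show ?thesis
    unfolding fibration_deriv_def[abs_def]
    by (intro has_derivative_scaleR bounded_linear.has_derivative[OF assms(1)] has_derivative_ident)
qed

text \<open>It suffices to invert the derivative \<open>\<xi> \<mapsto> r\<^sup>s (\<xi> + (s / r) dr(\<xi>) z)\<close> of the scaling; since \<open>dr(z) = r\<close>,
  this is a rank-one perturbation of \<open>r\<^sup>s id\<close> with factor \<open>1 + s\<close> on the line through \<open>z\<close>.\<close>

lemma surj_fibration_deriv:
  assumes "bounded_linear L" "surj L" "s \<ge> 0" "z \<noteq> 0"
  shows "surj (fibration_deriv s L z)"
proof (rule surjI)
  interpret L: bounded_linear L by fact
  interpret D: bounded_linear "radius_deriv z" by (rule bounded_linear_radius_deriv)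
  define \<zeta> where "\<zeta> w = inv L w" for w :: "real^3"
  have L: "L (\<zeta> w) = w" for w
    using assms(2) by (simp add: \<zeta>_def surj_f_inv_f)
  \<comment> \<open>\<open>c w\<close> solves \<open>c = s (dr(\<zeta> w) - c r) / r\<close>, so the
    two multiples of \<open>L z\<close> below cancel.\<close>
  define c where "c w = s * radius_deriv z (\<zeta> w) / (radius z * (1 + s))" for w :: "real^3"
  have pos: "radius z > 0" by (rule radius_pos) fact
  fix w
  have eq: "s * (radius_deriv z (\<zeta> w) - c w * radius z) / radius z = c w"
    using pos assms(3) by (simp add: c_def divide_simps) (simp add: algebra_simps)
  have "fibration_deriv s L z (radius z powr (- s) *\<^sub>R (\<zeta> w - c w *\<^sub>R z)) =
      w - c w *\<^sub>R L z + (s * (radius_deriv z (\<zeta> w) - c w * radius z) / radius z) *\<^sub>R L z"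
    using pos assms(4)
    by (simp add: fibration_deriv_def L.scaleR L.diff D.scaleR D.diff L radius_deriv_self
        powr_diff powr_minus field_simps)
  also have "\<dots> = w"
    unfolding eq by simp
  finally show "fibration_deriv s L z (radius z powr (- s) *\<^sub>R (\<zeta> w - c w *\<^sub>R z)) = w" .
qed

text \<open>Where \<open>u\<close> and \<open>v\<close> are both nonzero, the norms are smooth and
  the fibre is a regular level set.\<close>

lemma C1_submanifold3_fibre:
  fixes L :: "R6 \<Rightarrow> real^3"
  assumes L: "bounded_linear L" "surj L" and "s \<ge> 0"
    and z: "z \<in> F" "fst z \<noteq> 0" "snd z \<noteq> 0" and F: "F = {z \<in> M. radius z powr s *\<^sub>R L z = c}"
  shows "C1_submanifold3_at F z"
proof -
  define U :: "R6 set" where "U = {z. fst z \<noteq> 0} \<inter> {z. snd z \<noteq> 0}"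
  define g where "g y = radius y powr s *\<^sub>R L y - c" for y
  define g' where "g' y = Blinfun (fibration_deriv s L y)" for y
  have g': "blinfun_apply (g' y) = fibration_deriv s L y" for y
    unfolding g'_def by (intro bounded_linear_Blinfun_apply bounded_linear_fibration_deriv L)
  have "open U"
    unfolding U_def by (intro open_Int open_Collect_neq continuous_intros)
  moreover have "z \<in> U"
    using z by (simp add: U_def)
  moreover have "(g has_derivative blinfun_apply (g' y)) (at y)" if "y \<in> U" for y
    unfolding g_def[abs_def] g'
    using has_derivative_diff[OF fibration_has_derivative[OF L(1), of y s] has_derivative_const, of c]
      that by (simp add: U_def)
  moreover have "continuous_on U g'"
  \<comment> \<open>In finite dimension, continuity at each fixed argument gives continuity in
    operator norm.\<close>
  proof (rule continuous_on_blinfun_componentwise)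
    fix i :: R6
    have "radius y \<noteq> 0" if "y \<in> U" for y
      using that by (auto simp: U_def)
    then show "continuous_on U (\<lambda>y. blinfun_apply (g' y) i)"
      unfolding g' fibration_deriv_def radius_deriv_def
      by (intro continuous_intros continuous_on_radius bounded_linear.continuous_on[OF L(1)])
        (auto simp: U_def)
  qed
  moreover have "surj (blinfun_apply (g' y))" if "y \<in> U" for y
    unfolding g' using that by (intro surj_fibration_deriv assms) (auto simp: U_def)
  moreover have "F \<inter> U = {y \<in> U. g y = 0}"
    by (auto simp: F g_def U_def M_def)
  ultimately show ?thesis
    unfolding C1_submanifold3_at_def by blast
qed

text \<open>\<open>scaling s\<close> carries the fibre onto the affine space \<open>L = c\<close>
  without the origin, which \<open>P\<close> and \<open>J\<close> identify with an open subset of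
  \<open>real^3\<close>. Hence the whole fibre serves as the neighbourhood.\<close>

lemma locally_R3_fibre:
  fixes L P :: "R6 \<Rightarrow> real^3" and J :: "real^3 \<Rightarrow> R6"
  assumes L: "bounded_linear L" and s: "s \<ge> 0"
    and P: "continuous_on UNIV P" and J: "continuous_on UNIV J"
    and LJ: "\<And>w. L (J w) = c" and PJ: "\<And>w. P (J w) = w" and JP: "\<And>y. L y = c \<Longrightarrow> J (P y) = y"
    and F: "F = {z \<in> M. radius z powr s *\<^sub>R L z = c}" and "z \<in> F"
  shows "locally_R3_at F z"
proof -
  interpret L: bounded_linear L by fact
  \<comment> \<open>The solution of \<open>(1 + s) * (1 + t) = 1\<close>.\<close>
  define t where "t = - s / (1 + s)"
  have st: "s + t * (1 + s) = 0" "t + s * (1 + t) = 0"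
    using s by (simp_all add: t_def field_simps)
  have F': "F = {z. z \<noteq> 0 \<and> L (scaling s z) = c}"
    by (auto simp: F M_def scaling_def L.scaleR)
  define V where "V = {w. J w \<noteq> 0}"
  have "open V"
    unfolding V_def by (intro open_Collect_neq J continuous_intros)
  have "homeomorphism F V (\<lambda>z. P (scaling s z)) (\<lambda>w. scaling t (J w))"
  proof (rule homeomorphismI)
    show "continuous_on F (\<lambda>z. P (scaling s z))"
      by (rule continuous_on_compose2[OF P], rule continuous_on_subset[OF continuous_on_scaling])
        (auto simp: F')
    show "continuous_on V (\<lambda>w. scaling t (J w))"
      by (rule continuous_on_compose2[OF continuous_on_scaling], rule continuous_on_subset[OF J])
        (auto simp: V_def)
  qed (auto simp: F' V_def PJ JP LJ scaling_scaling st)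
  then have "F homeomorphic V"
    unfolding homeomorphic_def by blast
  then show ?thesis
    unfolding locally_R3_at_def
    using \<open>F homeomorphic V\<close> \<open>open V\<close> \<open>z \<in> F\<close> by (intro exI[of _ F] exI[of _ V]) simp
qed

section \<open>Tangent vectors of the fibres and the form on them\<close>

lemma tangent_vectors_stratum:
  assumes "\<xi> \<in> tangent_vectors (F \<inter> stratum z) z"
  shows "fst z = 0 \<Longrightarrow> fst \<xi> = 0" "snd z = 0 \<Longrightarrow> snd \<xi> = 0"
proof -
  obtain \<gamma> :: "real \<Rightarrow> R6" where \<gamma>: "\<And>t. \<gamma> t \<in> stratum z" "(\<gamma> has_vector_derivative \<xi>) (at 0)"
    using assms unfolding tangent_vectors_def by blast
  have "((\<lambda>t. fst (\<gamma> t)) has_vector_derivative fst \<xi>) (at 0)"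
    by (rule bounded_linear.has_vector_derivative[OF bounded_linear_fst \<gamma>(2)])
  then show "fst \<xi> = 0" if "fst z = 0"
    using \<gamma>(1) that by (simp add: stratum_def)
      (metis has_vector_derivative_const vector_derivative_unique_at)
  have "((\<lambda>t. snd (\<gamma> t)) has_vector_derivative snd \<xi>) (at 0)"
    by (rule bounded_linear.has_vector_derivative[OF bounded_linear_snd \<gamma>(2)])
  then show "snd \<xi> = 0" if "snd z = 0"
    using \<gamma>(1) that by (simp add: stratum_def)
      (metis has_vector_derivative_const vector_derivative_unique_at)
qed

text \<open>Differentiate the constant \<open>r\<^sup>s L\<close> along a curve in the fibre and
  divide by \<open>r\<^sup>s\<close>.\<close>

lemma tangent_vectors_fibre:
  fixes L :: "R6 \<Rightarrow> real^3"
  assumes L: "bounded_linear L" and z: "fst z \<noteq> 0" "snd z \<noteq> 0"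
    and \<xi>: "\<xi> \<in> tangent_vectors (F \<inter> S) z"
    and F: "F = {z \<in> M. radius z powr s *\<^sub>R L z = c}"
  shows "L \<xi> = - (s * radius_deriv z \<xi> / radius z) *\<^sub>R L z"
proof -
  obtain \<gamma> :: "real \<Rightarrow> R6" where \<gamma>: "\<gamma> 0 = z" "\<And>t. \<gamma> t \<in> F" "(\<gamma> has_vector_derivative \<xi>) (at 0)"
    using \<xi> unfolding tangent_vectors_def by blast
  have pos: "radius z > 0"
    using z by (intro radius_pos) auto
  have "((\<lambda>t. radius (\<gamma> t) powr s *\<^sub>R L (\<gamma> t)) has_vector_derivative fibration_deriv s L z \<xi>) (at 0)"
    using vector_derivative_diff_chain_within[of \<gamma> \<xi> 0 UNIV, OF \<gamma>(3)
        has_derivative_at_withinI[OF fibration_has_derivative[OF L, of "\<gamma> 0" s]]] z \<gamma>(1)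
    by (simp add: o_def)
  moreover have "(\<lambda>t. radius (\<gamma> t) powr s *\<^sub>R L (\<gamma> t)) = (\<lambda>t. c)"
    using \<gamma>(2) by (auto simp: F)
  ultimately have "fibration_deriv s L z \<xi> = 0"
    by (metis has_vector_derivative_const vector_derivative_unique_at)
  then have "radius z powr s *\<^sub>R (L \<xi> + (s * radius_deriv z \<xi> / radius z) *\<^sub>R L z) = 0"
    using pos by (simp add: fibration_deriv_def powr_diff scaleR_add_right mult.commute mult.left_commute)
  then show ?thesis
    using z by (auto simp: eq_neg_iff_add_eq_0)
qed

text \<open>If \<open>u = 0\<close>, only a multiple of \<open>dr \<and> (v \<bullet> dv)\<close>
  remains, and \<open>v \<bullet> dv = r dr\<close> there; likewise if \<open>v = 0\<close>.\<close>

lemma sigma0_singular_stratum: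
  assumes "fst z = 0 \<and> fst \<xi> = 0 \<and> fst \<eta> = 0 \<or> snd z = 0 \<and> snd \<xi> = 0 \<and> snd \<eta> = 0"
  shows "sigma0 z \<xi> \<eta> = 0"
  using assms by (auto simp: sigma0_def radius_deriv_def sgn_div_norm)

text \<open>Reduces each fibration to linear algebra. \<open>P\<close> is a complementary
  projection, so that \<open>J\<close> inverts the pair of \<open>L\<close> and
  \<open>P\<close>.\<close>

lemma has_lagrangian_fibres_scaled_linear:
  fixes L P :: "R6 \<Rightarrow> real^3" and J :: "real^3 \<Rightarrow> real^3 \<Rightarrow> R6"
  assumes \<sigma>: "descends_to (interior_product X phi) \<sigma>"
    and L: "bounded_linear L" and s: "s \<ge> 0"
    and P: "continuous_on UNIV P" and J: "\<And>c. continuous_on UNIV (J c)"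
    and LJ: "\<And>c w. L (J c w) = c" and PJ: "\<And>c w. P (J c w) = w" and JP: "\<And>y. J (L y) (P y) = y"
    and isotropic: "\<And>z \<xi> \<eta>. \<lbrakk>fst z \<noteq> 0; snd z \<noteq> 0;
        L \<xi> = - (s * radius_deriv z \<xi> / radius z) *\<^sub>R L z;
        L \<eta> = - (s * radius_deriv z \<eta> / radius z) *\<^sub>R L z\<rbrakk> \<Longrightarrow> sigma0 z \<xi> \<eta> = 0"
    and f: "\<And>z. z \<in> M \<Longrightarrow> f z = radius z powr s *\<^sub>R L z"
  shows "has_lagrangian_fibres \<sigma> f"
  unfolding has_lagrangian_fibres_def
proof
  fix c
  define F where "F = {z \<in> M. f z = c}"
  have F: "F = {z \<in> M. radius z powr s *\<^sub>R L z = c}"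
    using f by (auto simp: F_def)
  have "surj L"
    using LJ by (rule surjI)
  have "J c (P y) = y" if "L y = c" for y
    using JP that by blast
  then have "locally_R3_at F z" if "z \<in> F" for z
    using locally_R3_fibre[OF L s P J LJ PJ _ F that] by blast
  then have "three_dimensional F"
    unfolding three_dimensional_def
    using C1_submanifold3_fibre[OF L \<open>surj L\<close> s _ _ _ F] by blast
  moreover have "pulls_back_to_zero \<sigma> F"
    unfolding pulls_back_to_zero_def
  proof (intro ballI)
    fix z \<xi> \<eta>
    assume z: "z \<in> F" and \<xi>: "\<xi> \<in> tangent_vectors (F \<inter> stratum z) z"
      and \<eta>: "\<eta> \<in> tangent_vectors (F \<inter> stratum z) z"
    have "\<sigma> z \<xi> \<eta> = sigma0 z \<xi> \<eta>"
      using z by (intro descended_form_eq[OF \<sigma>] tangent_vectors_stratum[OF \<xi>]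
          tangent_vectors_stratum[OF \<eta>]) (auto simp: F_def)
    also have "\<dots> = 0"
    proof (cases "fst z \<noteq> 0 \<and> snd z \<noteq> 0")
      case True
      then show ?thesis
        using isotropic tangent_vectors_fibre[OF L _ _ \<xi> F] tangent_vectors_fibre[OF L _ _ \<eta> F]
        by blast
    next
      case False
      then show ?thesis
        using tangent_vectors_stratum[OF \<xi>] tangent_vectors_stratum[OF \<eta>]
        by (intro sigma0_singular_stratum) blast
    qed
    finally show "\<sigma> z \<xi> \<eta> = 0" .
  qed
  ultimately show "lagrangian \<sigma> {z \<in> M. f z = c}"
    by (simp add: lagrangian_def F_def)
qed

subsection \<open>The four fibrations\<close>

lemma inner_eq_norm_mult_sgn: "x \<bullet> y = norm x * (sgn x \<bullet> y)" for x :: "'a::real_inner"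
  by (cases "x = 0") (simp_all add: sgn_div_norm)

text \<open>The hypotheses say \<open>dp = 0\<close> on both vectors.\<close>

lemma sigma0_isotropic_sum:
  assumes "fst \<xi> + snd \<xi> = 0" "fst \<eta> + snd \<eta> = 0"
  shows "sigma0 z \<xi> \<eta> = 0"
proof -
  have "snd \<xi> = - fst \<xi>" "snd \<eta> = - fst \<eta>"
    using assms by (simp_all add: add_eq_0_iff)
  then show ?thesis by (simp add: sigma0_def inner_commute)
qed

text \<open>The hypotheses say \<open>dq = 0\<close>, that is
  \<open>dr (u - v) + r (du - dv) = 0\<close>, on both vectors.\<close>

lemma sigma0_isotropic_diff:
  assumes "radius z \<noteq> 0"
    and "fst \<xi> - snd \<xi> = - (radius_deriv z \<xi> / radius z) *\<^sub>R (fst z - snd z)"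
    and "fst \<eta> - snd \<eta> = - (radius_deriv z \<eta> / radius z) *\<^sub>R (fst z - snd z)"
  shows "sigma0 z \<xi> \<eta> = 0"
proof -
  have *: "radius_deriv z \<xi> *\<^sub>R (fst z - snd z) = - radius z *\<^sub>R (fst \<xi> - snd \<xi>)"
     "radius_deriv z \<eta> *\<^sub>R (fst z - snd z) = - radius z *\<^sub>R (fst \<eta> - snd \<eta>)"
    using assms by simp_all
  have "sigma0 z \<xi> \<eta> = radius z * (fst \<xi> \<bullet> snd \<eta> - fst \<eta> \<bullet> snd \<xi>)
     + ((radius_deriv z \<xi> *\<^sub>R (fst z - snd z)) \<bullet> (fst \<eta> + snd \<eta>)
        - (radius_deriv z \<eta> *\<^sub>R (fst z - snd z)) \<bullet> (fst \<xi> + snd \<xi>)) / 2"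
    by (simp add: sigma0_def)
  also have "\<dots> = 0"
    unfolding * by (simp add: inner_simps inner_commute field_simps)
  finally show ?thesis .
qed

text \<open>Exchanging \<open>u\<close> and \<open>v\<close> fixes \<open>p\<close> and negates
  \<open>q\<close>. This reduces the fourth map to the third.\<close>

lemma sigma0_swap: "sigma0 (prod.swap z) (prod.swap \<xi>) (prod.swap \<eta>) = - sigma0 z \<xi> \<eta>"
proof -
  have "radius (prod.swap z) = radius z"
    by (simp add: radius_def)
  moreover have "radius_deriv (prod.swap z) (prod.swap \<zeta>) = radius_deriv z \<zeta>" for \<zeta>
    by (simp add: radius_deriv_def)
  ultimately show ?thesis
    by (simp add: sigma0_def inner_diff_left inner_add_right inner_commute[of "snd \<xi>"]
        inner_commute[of "snd \<eta>"] field_simps)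
qed

text \<open>The \<open>u \<bullet> dv\<close> terms cancel. What remains is \<open>dr\<close> wedged
  with \<open>u \<bullet> du\<close>, \<open>v \<bullet> du\<close> and
  \<open>v \<bullet> dv\<close>, each a multiple of \<open>dr\<close> on these vectors.\<close>

lemma sigma0_isotropic_fst:
  assumes r: "radius z \<noteq> 0"
    and "fst \<xi> = - (radius_deriv z \<xi> / (2 * radius z)) *\<^sub>R fst z"
    and "fst \<eta> = - (radius_deriv z \<eta> / (2 * radius z)) *\<^sub>R fst z"
  shows "sigma0 z \<xi> \<eta> = 0"
proof -
  have snd: "snd z \<bullet> snd \<zeta> = norm (snd z) * (radius_deriv z \<zeta> - sgn (fst z) \<bullet> fst \<zeta>)" for \<zeta>
    by (simp add: radius_deriv_def inner_eq_norm_mult_sgn[of "snd z"])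
  show ?thesis
    unfolding sigma0_def inner_diff_left inner_add_right snd
    unfolding assms(2,3) using r by (simp add: field_simps)
qed

theorem corollary7p3:
  fixes \<sigma> :: "R6 form2"
  assumes "descends_to (interior_product X phi) \<sigma>"
  shows "has_lagrangian_fibres \<sigma> (\<lambda>(u, v). u + v) \<and>
         has_lagrangian_fibres \<sigma> (\<lambda>(u, v). (norm u + norm v) *\<^sub>R (u - v)) \<and>
         has_lagrangian_fibres \<sigma> (\<lambda>(u, v). sqrt (norm u + norm v) *\<^sub>R u) \<and>
         has_lagrangian_fibres \<sigma> (\<lambda>(u, v). sqrt (norm u + norm v) *\<^sub>R v)"
proof (intro conjI)
  note fibres = has_lagrangian_fibres_scaled_linear[OF assms]
  have nz: "radius z \<noteq> 0" if "fst z \<noteq> 0" for z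
    using that by auto
  have sqrt: "radius z powr (1 / 2) = sqrt (radius z)" for z
    using radius_nonneg by (rule powr_half_sqrt)
  show "has_lagrangian_fibres \<sigma> (\<lambda>(u, v). u + v)"
    \<comment> \<open>\<open>radius z powr 0\<close> is \<open>1\<close> only off the origin, as
      \<open>0 powr 0 = 0\<close>; hence the use of \<open>M_def\<close>.\<close>
    by (rule fibres[where L = "\<lambda>z. fst z + snd z" and s = 0 and P = fst and J = "\<lambda>c w. (w, c - w)"])
      (auto intro!: bounded_linear_add bounded_linear_fst bounded_linear_snd continuous_intros
        sigma0_isotropic_sum simp: M_def)
  show "has_lagrangian_fibres \<sigma> (\<lambda>(u, v). (norm u + norm v) *\<^sub>R (u - v))"
    by (rule fibres[where L = "\<lambda>z. fst z - snd z" and s = 1 and P = fst and J = "\<lambda>c w. (w, w - c)"])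
      (auto intro!: bounded_linear_sub bounded_linear_fst bounded_linear_snd continuous_intros
        sigma0_isotropic_diff nz simp: radius_def add_nonneg_nonneg)
  show "has_lagrangian_fibres \<sigma> (\<lambda>(u, v). sqrt (norm u + norm v) *\<^sub>R u)"
    by (rule fibres[where L = fst and s = "1/2" and P = snd and J = "\<lambda>c w. (c, w)"])
      (auto intro!: bounded_linear_fst continuous_intros sigma0_isotropic_fst nz
        simp: sqrt, auto simp: radius_def)
  show "has_lagrangian_fibres \<sigma> (\<lambda>(u, v). sqrt (norm u + norm v) *\<^sub>R v)"
  proof (rule fibres[where L = snd and s = "1/2" and P = fst and J = "\<lambda>c w. (w, c)"])
    fix z \<xi> \<eta> :: R6
    assume z: "fst z \<noteq> 0"
      and "snd \<xi> = - (1/2 * radius_deriv z \<xi> / radius z) *\<^sub>R snd z"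
      and "snd \<eta> = - (1/2 * radius_deriv z \<eta> / radius z) *\<^sub>R snd z"
    then have "sigma0 (prod.swap z) (prod.swap \<xi>) (prod.swap \<eta>) = 0"
      using nz[OF z]
      by (intro sigma0_isotropic_fst) (simp_all add: radius_def radius_deriv_def add.commute)
    then show "sigma0 z \<xi> \<eta> = 0"
      by (simp add: sigma0_swap)
  qed (auto intro!: bounded_linear_snd continuous_intros simp: sqrt, auto simp: radius_def)
qed

end
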